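(* For $h\ge 0$ let $\mathcal{S}_h(X)=\sum_{L\ge0}s(L,h)X^L$ (formal power series). Then $\mathcal{S}_0(X)=\dfrac{1}{1-X}$, $\mathcal{S}_1(X)=\dfrac{X}{(1-X)^2}$, and for all $h\ge2$, $$\mathcal{S}_h(X)=\frac{\mathcal{F}_h(X)}{(1-X^{h-1})(1-X^h)(1-X^{h+1})},$$ where $$\mathcal{F}_h(X)=(1-X^{h-1})\bigl(V_{2h,h}-V_{h,h}X^h-V_{h-1,h}X^{h+1}-X^{2h-1}\bigr)+(1+X)B_h,$$ $$V_{n,h}=\sum_{L=0}^{n-1}s(L,h)X^L,\qquad B_h=\sum_{r=0}^{h-2}s(h-1,r)X^{r+2h-1}.$$
   Context: For a finite word $w$ over $\{0,1\}$, $|w|$ is its length and $|w|_0,|w|_1$ are its numbers of $0$'s and $1$'s; $|w|_1$ is the height of $w$. A subword means a contiguous factor. A word $w$ is balanced if for all finite subwords $u,v$ of $w$ with $|u|=|v|$ one has $\bigl||u|_0-|v|_0\bigr|\le 1$. For $0\le h\le L$, $\mathbb{S}(L,h)$ is the set of balanced words in $\{0,1\}^*$ of length $L$ and height $h$. The function $s:\mathbb{Z}^2\to\mathbb{N}$ is defined by $s(L,h)=\#\mathbb{S}(L,h\bmod L)$ if $L>0$ (with $h\bmod L\in\{0,\dots,L-1\}$), $s(0,0)=1$, and $s(L,h)=0$ if $L<0$ or if $L=0$ and $h\ne0$. *)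

theory Defs
  imports
    "HOL-Library.Sublist"
    "HOL-Computational_Algebra.Formal_Power_Series"
begin

(* sublist is the contiguous-factor relation. *)
definition balanced :: "nat list \<Rightarrow> bool" where
  "balanced w \<longleftrightarrow> (\<forall>u v. sublist u w \<longrightarrow> sublist v w \<longrightarrow> length u = length v \<longrightarrow>
     \<bar>int (count_list u 0) - int (count_list v 0)\<bar> \<le> 1)"

definition balanced_words :: "nat \<Rightarrow> nat \<Rightarrow> nat list set" where
  "balanced_words L h = {w \<in> lists {0, 1}. length w = L \<and> count_list w 1 = h \<and> balanced w}"

(* For L > 0 the integer h mod L lies in {0..<L}, so the conversions by nat lose nothing. *)
definition s :: "int \<Rightarrow> int \<Rightarrow> nat" where
  "s L h = (if L > 0 then card (balanced_words (nat L) (nat (h mod L)))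
            else if L = 0 \<and> h = 0 then 1
            else 0)"

(* Rational coefficients, so that fps division is available. *)
definition S_series :: "nat \<Rightarrow> rat fps" where
  "S_series h = Abs_fps (\<lambda>L. of_nat (s (int L) (int h)))"

definition V_poly :: "nat \<Rightarrow> nat \<Rightarrow> rat fps" where
  "V_poly n h = (\<Sum>L<n. fps_const (of_nat (s (int L) (int h))) * fps_X ^ L)"

(* V_poly, B_poly and F_poly are polynomials, kept in the type of power series.
   The natural-number subtractions in B_poly and F_poly are exact for h >= 2, the only
   range in which they are used. *)
definition B_poly :: "nat \<Rightarrow> rat fps" where
  "B_poly h = (\<Sum>r = 0..h - 2. fps_const (of_nat (s (int h - 1) (int r))) * fps_X ^ (r + 2 * h - 1))"

definition F_poly :: "nat \<Rightarrow> rat fps" where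
  "F_poly h =
     (1 - fps_X ^ (h - 1)) *
       (V_poly (2 * h) h - V_poly h h * fps_X ^ h - V_poly (h - 1) h * fps_X ^ (h + 1)
        - fps_X ^ (2 * h - 1))
     + (1 + fps_X) * B_poly h"

end

theory Submission
  imports Defs
begin

text \<open>
  A balanced word with values in two consecutive integers is encoded by its sequence of partial
  sums; subtracting a linear function reduces the height modulo the length, so that the convention
  \<open>s L h = s L (h mod L)\<close> becomes a count of integer paths. Dually, such a path is given by the
  positions \<open>p 1 \<le> \<dots> \<le> p h\<close> of its unit increments, completed by \<open>p 0 = 0\<close> and \<open>p (h + 1) = L + 1\<close>.
  It is balanced iff every sum of \<open>m\<close> consecutive gaps exceeds every such sum of inner gaps by
  at most one. Subtracting one from all gaps preserves this, which handles the words with both outer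
  gaps larger than \<open>1\<close>. If the outer gap at one end equals \<open>1\<close>, the constraints involving it
  are void and one may subtract one from all other gaps. If both outer gaps equal \<open>1\<close>, the inner
  gaps are an arbitrary balanced path of length \<open>h - 1\<close> and height \<open>L - 1\<close>. Adding up, for
  \<open>L \<ge> 2 * h\<close>,
  \<open>s L h = s (L - h) h + s (L - h - 1) h - s (L - 2 * h - 1) h + s (h - 1) (L - 1) + s (h - 1) (L - 2)\<close>,
  which is the claim on the level of coefficients.
\<close>

unbundle fps_syntax

section \<open>Balanced integer paths and their dual position sequences\<close>

text \<open>Freezing \<open>f\<close> at \<open>h\<close> beyond \<open>L\<close> gives each path
  exactly one representing function, so that cardinalities are meaningful. The height is an
  arbitrary integer: steps are not confined to 0 and 1.\<close>

definition bal_paths :: "nat \<Rightarrow> int \<Rightarrow> (nat \<Rightarrow> int) set" where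
  "bal_paths L h = {f. f 0 = 0 \<and> (\<forall>n\<ge>L. f n = h) \<and>
     (\<forall>a b l. a + l \<le> L \<longrightarrow> b + l \<le> L \<longrightarrow> f (a + l) - f a \<le> f (b + l) - f b + 1)}"

text \<open>The indices \<open>j\<close> and \<open>j + m\<close> may be the artificial end points \<open>0\<close> and \<open>h + 1\<close>, whereas
  \<open>i\<close> and \<open>i + m\<close> must be genuine positions. Monotonicity of \<open>p\<close> is a consequence when \<open>h \<ge> 2\<close>.\<close>

definition dual_paths :: "nat \<Rightarrow> int \<Rightarrow> (nat \<Rightarrow> int) set" where
  "dual_paths h L = {p. p 0 = 0 \<and> 1 \<le> p 1 \<and> p h \<le> L \<and> (\<forall>k>h. p k = L + 1) \<and>
     (\<forall>i j m. 1 \<le> i \<longrightarrow> i + m \<le> h \<longrightarrow> j + m \<le> h + 1 \<longrightarrow>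
        p (j + m) - p j \<le> p (i + m) - p i + 1)}"

lemma bal_pathsD:
  assumes "f \<in> bal_paths L h"
  shows "f 0 = 0" "\<And>n. n \<ge> L \<Longrightarrow> f n = h"
    "\<And>a b l. a + l \<le> L \<Longrightarrow> b + l \<le> L \<Longrightarrow> f (a + l) - f a \<le> f (b + l) - f b + 1"
  using assms by (auto simp: bal_paths_def)

lemma dual_pathsD:
  assumes "p \<in> dual_paths h L"
  shows "p 0 = 0" "1 \<le> p 1" "p h \<le> L" "\<And>k. k > h \<Longrightarrow> p k = L + 1"
    "\<And>i j m. 1 \<le> i \<Longrightarrow> i + m \<le> h \<Longrightarrow> j + m \<le> h + 1 \<Longrightarrow>
        p (j + m) - p j \<le> p (i + m) - p i + 1"
  using assms by (auto simp: dual_paths_def)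

section \<open>Balanced words as integer paths\<close>

text \<open>By the balance condition with \<open>l = 1\<close>, any two steps differ by at most one.
  A step below the floor \<open>q\<close> of the mean would force all steps to be at most
  \<open>q\<close>, and the total below \<open>L * q\<close>; a step above \<open>q + 1\<close>
  would force all of them to be at least \<open>q + 1\<close>, and the total above
  \<open>h\<close>.\<close>

lemma bal_paths_step:
  assumes f: "f \<in> bal_paths L h" and n: "n < L"
  shows "h div int L \<le> f (Suc n) - f n" "f (Suc n) - f n \<le> h div int L + 1"
proof -
  let ?q = "h div int L"
  have L: "int L > 0" using n by simp
  have h: "h = int L * ?q + h mod int L" "0 \<le> h mod int L" "h mod int L < int L"
    using L by simp_all
  have tot: "(\<Sum>i<L. f (Suc i) - f i) = h"
    using bal_pathsD(1,2)[OF f] by (simp add: sum_lessThan_telescope)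
  have le: "f (Suc a) - f a \<le> f (Suc b) - f b + 1" if "a < L" "b < L" for a b
    using bal_pathsD(3)[OF f, of a 1 b] that by simp
  show "?q \<le> f (Suc n) - f n"
  proof (rule ccontr)
    assume c: "\<not> ?q \<le> f (Suc n) - f n"
    have "(\<Sum>i<L. f (Suc i) - f i) < (\<Sum>i<L. ?q)"
    proof (rule sum_strict_mono_ex1)
      show "\<forall>i\<in>{..<L}. f (Suc i) - f i \<le> ?q" using le[OF _ n] c by force
      show "\<exists>i\<in>{..<L}. f (Suc i) - f i < ?q" using n c by (intro bexI[of _ n]) auto
    qed simp
    then show False using tot h by simp
  qed
  show "f (Suc n) - f n \<le> ?q + 1"
  proof (rule ccontr)
    assume c: "\<not> f (Suc n) - f n \<le> ?q + 1"
    have "(\<Sum>i<L. ?q + 1) \<le> (\<Sum>i<L. f (Suc i) - f i)"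
    proof (rule sum_mono)
      fix i assume "i \<in> {..<L}"
      then show "?q + 1 \<le> f (Suc i) - f i" using le[OF n, of i] c by force
    qed
    then show False using tot h by (simp add: algebra_simps)
  qed
qed

text \<open>Windows of equal length have opposite differences in their numbers of 0's and of 1's, so
  ones may be counted instead of zeros. The absolute value disappears because \<open>a\<close> and
  \<open>b\<close> can be exchanged.\<close>

lemma balanced_iff_prefix_counts:
  assumes "w \<in> lists {0, 1}"
  shows "balanced w \<longleftrightarrow> (\<forall>a b l. a + l \<le> length w \<longrightarrow> b + l \<le> length w \<longrightarrow>
    int (count_list (take (a + l) w) 1) - int (count_list (take a w) 1)
    \<le> int (count_list (take (b + l) w) 1) - int (count_list (take b w) 1) + 1)"
    (is "_ \<longleftrightarrow> ?R")
proof -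
  have c01: "int (count_list u 0) = int (length u) - int (count_list u 1)"
    if "u \<in> lists {0, 1}" for u :: "nat list"
    using that by (induction u) auto
  have win: "int (count_list (take l (drop a w)) 1)
      = int (count_list (take (a + l) w) 1) - int (count_list (take a w) 1)" for a l
    by (simp add: take_add)
  have sub: "sublist (take l (drop a w)) w" for a l
    by (metis sublist_drop sublist_order.dual_order.trans sublist_take)
  have sub': "\<exists>a. a + length u \<le> length w \<and> u = take (length u) (drop a w)" if "sublist u w" for u
  proof -
    from that obtain ps ss where "w = ps @ u @ ss" by (auto simp: sublist_def)
    then show ?thesis by (intro exI[of _ "length ps"]) simp
  qed
  have lists: "u \<in> lists {0, 1}" if "sublist u w" for u
    using set_mono_sublist[OF that] assms by auto
  show ?thesis
  proof
    assume b: "balanced w"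
    show ?R
    proof (intro allI impI)
      fix a b l assume ab: "a + l \<le> length w" "b + l \<le> length w"
      let ?u = "take l (drop a w)" and ?v = "take l (drop b w)"
      have len: "length ?u = l" "length ?v = l" using ab by auto
      have "\<bar>int (count_list ?u 0) - int (count_list ?v 0)\<bar> \<le> 1"
        using b sub len unfolding balanced_def by metis
      then have "\<bar>int (count_list ?u 1) - int (count_list ?v 1)\<bar> \<le> 1"
        using c01[OF lists[OF sub]] len by (smt (verit))
      then show "int (count_list (take (a + l) w) 1) - int (count_list (take a w) 1)
        \<le> int (count_list (take (b + l) w) 1) - int (count_list (take b w) 1) + 1"
        unfolding win by linarith
    qed
  next
    assume R: ?R
    show "balanced w"
      unfolding balanced_def
    proof (intro allI impI)
      fix u v assume uv: "sublist u w" "sublist v w" and len: "length u = length v"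
      from sub'[OF uv(1)] obtain a where a: "a + length u \<le> length w" "u = take (length u) (drop a w)" by blast
      from sub'[OF uv(2)] obtain b where b: "b + length u \<le> length w" "v = take (length u) (drop b w)"
        using len by metis
      have "int (count_list u 1) \<le> int (count_list v 1) + 1"
        using R[rule_format, OF a(1) b(1)] win[of "length u" a] win[of "length u" b] a(2) b(2) by simp
      moreover have "int (count_list v 1) \<le> int (count_list u 1) + 1"
        using R[rule_format, OF b(1) a(1)] win[of "length u" a] win[of "length u" b] a(2) b(2) by simp
      ultimately show "\<bar>int (count_list u 0) - int (count_list v 0)\<bar> \<le> 1"
        using c01[OF lists[OF uv(1)]] c01[OF lists[OF uv(2)]] len by linarith
    qed
  qed
qed

text \<open>Adding a line of slope \<open>h div L\<close> to the prefix counts turns the reduced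
  height \<open>h mod L\<close> into \<open>h\<close>. The line cancels in the comparison of windows
  of equal length, and by \<open>bal_paths_step\<close> subtracting the slope from the steps of any
  path gives letters 0 and 1 again.\<close>

lemma bij_balanced_words_bal_paths:
  assumes L: "L > 0"
  shows "bij_betw (\<lambda>w n. int (count_list (take n w) 1) + h div int L * int (min n L))
    (balanced_words L (nat (h mod int L))) (bal_paths L h)"
proof -
  define q where "q = h div int L"
  define \<Phi> where "\<Phi> = (\<lambda>w n. int (count_list (take n w) (1::nat)) + q * int (min n L))"
  define \<Psi> where "\<Psi> = (\<lambda>f. map (\<lambda>i. nat (f (Suc i) - f i - q)) [0..<L])"
  have h: "h = int L * q + h mod int L" "0 \<le> h mod int L" "h mod int L < int L"
    using L by (simp_all add: q_def)
  have step: "count_list (take (Suc i) w) 1 = count_list (take i w) 1 + w ! i"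
    if "i < length w" "w \<in> lists {0, 1}" for i and w :: "nat list"
    using that nth_mem[OF that(1)] by (auto simp: take_Suc_conv_app_nth)
  have bw: "\<Phi> w \<in> bal_paths L h \<and> \<Psi> (\<Phi> w) = w" if w: "w \<in> balanced_words L (nat (h mod int L))" for w
  proof
    from w have w': "w \<in> lists {0, 1}" "length w = L" "int (count_list w 1) = h mod int L" "balanced w"
      using h by (auto simp: balanced_words_def)
    show "\<Phi> w \<in> bal_paths L h"
      unfolding bal_paths_def
    proof (intro CollectI conjI allI impI)
      show "\<Phi> w 0 = 0" by (simp add: \<Phi>_def)
      show "\<Phi> w n = h" if "L \<le> n" for n
        using that w' h by (simp add: \<Phi>_def mult.commute min_def)
      fix a b l assume ab: "a + l \<le> L" "b + l \<le> L"
      then show "\<Phi> w (a + l) - \<Phi> w a \<le> \<Phi> w (b + l) - \<Phi> w b + 1"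
        using balanced_iff_prefix_counts[OF w'(1)] w'(2,4)
        by (simp add: \<Phi>_def algebra_simps) 
    qed
    show "\<Psi> (\<Phi> w) = w"
    proof (rule nth_equalityI)
      show "length (\<Psi> (\<Phi> w)) = length w" by (simp add: \<Psi>_def w')
      fix i assume "i < length (\<Psi> (\<Phi> w))"
      then have i: "i < L" by (simp add: \<Psi>_def)
      then show "\<Psi> (\<Phi> w) ! i = w ! i"
        using step[of i w] w' by (simp add: \<Psi>_def \<Phi>_def algebra_simps)
    qed
  qed
  have pw: "\<Psi> f \<in> balanced_words L (nat (h mod int L)) \<and> \<Phi> (\<Psi> f) = f" if f: "f \<in> bal_paths L h" for f
  proof -
    have f01: "f (Suc i) - f i = q \<or> f (Suc i) - f i = q + 1" if "i < L" for i
      using bal_paths_step[OF f that] unfolding q_def by linarith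
    have len: "length (\<Psi> f) = L" by (simp add: \<Psi>_def)
    have l01: "\<Psi> f \<in> lists {0, 1}" using f01 by (fastforce simp: \<Psi>_def)
    have cnt: "int (count_list (take n (\<Psi> f)) 1) = f n - q * int n" if "n \<le> L" for n
      using that
    proof (induction n)
      case 0 then show ?case using bal_pathsD(1)[OF f] by simp
    next
      case (Suc n)
      then have "int (\<Psi> f ! n) = f (Suc n) - f n - q"
        using f01[of n] by (auto simp: \<Psi>_def)
      then show ?case using step[of n "\<Psi> f"] Suc len l01 by (simp add: algebra_simps)
    qed
    have inv: "\<Phi> (\<Psi> f) = f"
    proof
      fix n show "\<Phi> (\<Psi> f) n = f n"
        using cnt[of n] cnt[of L] len bal_pathsD(2)[OF f, of n] bal_pathsD(2)[OF f, of L]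
        by (cases "n \<le> L") (auto simp: \<Phi>_def min_def)
    qed
    have "balanced (\<Psi> f)"
      unfolding balanced_iff_prefix_counts[OF l01]
    proof (intro allI impI)
      fix a b l assume "a + l \<le> length (\<Psi> f)" "b + l \<le> length (\<Psi> f)"
      then show "int (count_list (take (a + l) (\<Psi> f)) 1) - int (count_list (take a (\<Psi> f)) 1)
        \<le> int (count_list (take (b + l) (\<Psi> f)) 1) - int (count_list (take b (\<Psi> f)) 1) + 1"
        using bal_pathsD(3)[OF f, of a l b] by (simp add: cnt len algebra_simps del: One_nat_def)
    qed
    moreover have "int (count_list (\<Psi> f) 1) = h mod int L"
      using cnt[of L] len bal_pathsD(2)[OF f, of L] h by (simp add: mult.commute)
    ultimately show ?thesis using inv len l01 by (auto simp: balanced_words_def)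
  qed
  have "bij_betw \<Phi> (balanced_words L (nat (h mod int L))) (bal_paths L h)"
    by (rule bij_betw_byWitness[where f' = \<Psi>]) (use bw pw in auto)
  then show ?thesis by (simp add: \<Phi>_def q_def)
qed

lemma finite_balanced_words: "finite (balanced_words L h)"
  by (rule finite_subset[OF _ finite_lists_length_eq[of "{0, 1}" L]]) (auto simp: balanced_words_def)

lemma s_eq_card_bal_paths:
  assumes "L > 0"
  shows "s (int L) h = card (bal_paths L h)" "finite (bal_paths L h)"
proof -
  note b = bij_balanced_words_bal_paths[OF assms, of h]
  show "s (int L) h = card (bal_paths L h)"
    using bij_betw_same_card[OF b] assms by (simp add: s_def)
  show "finite (bal_paths L h)"
    using bij_betw_finite[OF b] finite_balanced_words by simp
qed

section \<open>Duality between paths and position sequences\<close>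

lemma bal_paths_mono:
  assumes f: "f \<in> bal_paths L h" and "h \<ge> 0" "L > 0"
  shows "mono f"
proof (rule incseq_SucI)
  fix n
  show "f n \<le> f (Suc n)"
  proof (cases "n < L")
    case True
    have "0 \<le> h div int L" using assms by (simp add: pos_imp_zdiv_nonneg_iff)
    then show ?thesis using bal_paths_step(1)[OF f True] by linarith
  next
    case False then show ?thesis using bal_pathsD(2)[OF f] by simp
  qed
qed

text \<open>Every gap is within one of the first gap from below, and the first gap is at least 1;
  hence inner gaps are nonnegative.\<close>

lemma dual_paths_mono:
  assumes p: "p \<in> dual_paths h L" and "h \<ge> 2"
  shows "mono p"
proof (rule incseq_SucI)
  fix k
  consider "k = 0" | "1 \<le> k" "k < h" | "k = h" | "k > h" by linarith
  then show "p k \<le> p (Suc k)"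
  proof cases
    case 2
    then show ?thesis using dual_pathsD(5)[OF p, of k 1 0] dual_pathsD(1,2)[OF p] assms by simp
  qed (use dual_pathsD[OF p] in auto)
qed

text \<open>The value at \<open>k\<close> is the first time at which \<open>f\<close> reaches
  \<open>k\<close>, or \<open>L + 1\<close> if it never does. Path and position sequence determine
  each other through a Galois connection, which also turns a violation of one balance condition into
  a violation of the other.\<close>

lemma bij_bal_paths_dual_paths:
  fixes h L :: nat
  assumes h: "h \<ge> 2" and L: "L > 0"
  shows "bij_betw (\<lambda>f k. int (card {n. n \<le> L \<and> f n < int k})) (bal_paths L (int h)) (dual_paths h (int L))"
proof -
  define \<Phi> where "\<Phi> = (\<lambda>(f::nat\<Rightarrow>int) k. int (card {n. n \<le> L \<and> f n < int k}))"
  define \<Psi> where "\<Psi> = (\<lambda>(p::nat\<Rightarrow>int) n. int (card {k. 1 \<le> k \<and> k \<le> h \<and> p k \<le> int n}))"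
  \<comment> \<open>A finite initial segment of the naturals is determined by its cardinality; this
    turns the counts defining \<open>\<Phi>\<close> and \<open>\<Psi>\<close> into the Galois
    connections \<open>gal\<close> and \<open>gal'\<close>.\<close>
  have down: "n \<in> S \<longleftrightarrow> n < card S"
    if "finite S" "\<And>x y. x \<le> y \<Longrightarrow> y \<in> S \<Longrightarrow> x \<in> S" for S :: "nat set" and n
  proof -
    have "S \<subseteq> {..<card S}"
    proof
      fix y assume "y \<in> S"
      then have "{..y} \<subseteq> S" using that(2) by auto
      from card_mono[OF that(1) this] show "y \<in> {..<card S}" by simp
    qed
    then have "S = {..<card S}" by (simp add: card_subset_eq)
    then show ?thesis by auto
  qed
  have pd: "\<Phi> f \<in> dual_paths h (int L) \<and> \<Psi> (\<Phi> f) = f" if f: "f \<in> bal_paths L (int h)" for f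
  proof -
    define p where "p = \<Phi> f"
    note fD = bal_pathsD[OF f]
    have m: "mono f" using bal_paths_mono[OF f] L by simp
    have f0: "0 \<le> f n" for n using monoD[OF m, of 0 n] fD(1) by simp
    have fh: "f n \<le> int h" for n
      using monoD[OF m, of n "max n L"] fD(2)[of "max n L"] by simp
    have gal: "int n < p k \<longleftrightarrow> f n < int k" if n: "n \<le> L" for n k
    proof -
      let ?S = "{n. n \<le> L \<and> f n < int k}"
      have "n \<in> ?S \<longleftrightarrow> n < card ?S"
        by (rule down) (auto intro: le_less_trans[OF monoD[OF m]])
      then show ?thesis using n by (simp add: p_def \<Phi>_def)
    qed
    have pnn: "0 \<le> p k" for k by (simp add: p_def \<Phi>_def)
    have pmono: "p j \<le> p k" if "j \<le> k" for j k
      using that by (auto simp: p_def \<Phi>_def intro!: card_mono)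
    have p0: "p 0 = 0" using f0 by (simp add: p_def \<Phi>_def not_less)
    have p1: "1 \<le> p 1" using gal[of 0 1] fD(1) by simp
    have ph: "p k \<le> int L" if "k \<le> h" for k
      using gal[of L k] fD(2)[of L] that by simp
    have pL: "p k = int L + 1" if "k > h" for k
    proof -
      have "{n. n \<le> L \<and> f n < int k} = {..L}" using fh that by (auto intro: le_less_trans[OF fh])
      then show ?thesis by (simp add: p_def \<Phi>_def)
    qed
    have pL': "p k \<le> int L + 1" for k using ph[of k] pL[of k] by (cases "k \<le> h") auto
    have C: "p (j + m) - p j \<le> p (i + m) - p i + 1"
      if "1 \<le> i" "i + m \<le> h" "j + m \<le> h + 1" for i j m
    proof (rule ccontr)
      assume c: "\<not> ?thesis"
      have pi: "p i \<le> p (i + m)" "1 \<le> p i" using pmono[of i "i + m"] pmono[OF that(1)] p1 by auto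
      \<comment> \<open>Compare the open interval between positions \<open>j\<close> and \<open>j + m\<close> with a window of the same
        length containing the closed interval from position \<open>i\<close> to \<open>i + m\<close>.\<close>
      define l where "l = nat (p (j + m) - p j - 1)"
      define a where "a = nat (p j)"
      define b where "b = nat (p i - 1)"
      define e where "e = nat (p (i + m))"
      have l: "int l = p (j + m) - p j - 1" using c pi by (simp add: l_def)
      have a: "int a = p j" using pnn by (simp add: a_def)
      have b: "int b = p i - 1" using pi by (simp add: b_def)
      have e: "int e = p (i + m)" using pnn by (simp add: e_def)
      have al: "a + l \<le> L" using l a pL'[of "j + m"] by linarith
      have "f (a + l) < int (j + m)" using gal[OF al, of "j + m"] a l by simp
      moreover have "f a \<ge> int j" using gal[of a j] a al by simp
      ultimately have light: "f (a + l) - f a \<le> int m - 1" by simp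
      have eL: "e \<le> L" using e ph[OF that(2)] by simp
      have be: "b \<le> e" "e \<le> b + l" using b e pi l c by linarith+
      have "f b < int i" using gal[of b i] b be eL by simp
      moreover have "f e \<ge> int (i + m)" using gal[of e "i + m"] e eL by simp
      \<comment> \<open>The window starting at \<open>b\<close> might run past \<open>L\<close>; it
        is then moved left until it ends at \<open>L\<close>. It still contains \<open>b\<close> and
        \<open>e\<close>, so its increment is at least \<open>m + 1\<close>.\<close>
      moreover define b' where "b' = min b (L - l)"
      have "f b' \<le> f b" "f e \<le> f (b' + l)"
        using be eL al by (auto intro!: monoD[OF m] simp: b'_def)
      moreover have "b' + l \<le> L" using al by (simp add: b'_def)
      then have "f (b' + l) - f b' \<le> f (a + l) - f a + 1" using fD(3)[OF _ al] by blast
      ultimately show False using light by simp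
    qed
    have "\<Psi> p = f"
    proof
      fix n
      show "\<Psi> p n = f n"
      proof (cases "n \<le> L")
        case True
        have "{k. 1 \<le> k \<and> k \<le> h \<and> p k \<le> int n} = {1..nat (f n)}"
          using gal[OF True] fh[of n] f0[of n] by (auto simp: not_less[symmetric] le_nat_iff) 
        then show ?thesis using f0 by (simp add: \<Psi>_def)
      next
        case False
        have "{k. 1 \<le> k \<and> k \<le> h \<and> p k \<le> int n} = {1..h}" using ph False by force
        then show ?thesis using fD(2)[of n] False by (simp add: \<Psi>_def)
      qed
    qed
    moreover have "p \<in> dual_paths h (int L)"
      unfolding dual_paths_def using p0 p1 ph[of h] pL C by blast
    ultimately show ?thesis by (simp add: p_def)
  qed
  have bw: "\<Psi> p \<in> bal_paths L (int h) \<and> \<Phi> (\<Psi> p) = p" if p: "p \<in> dual_paths h (int L)" for p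
  proof -
    define f where "f = \<Psi> p"
    note pD = dual_pathsD[OF p]
    have m: "mono p" using dual_paths_mono[OF p h] .
    have p1: "1 \<le> p k" if "1 \<le> k" for k using monoD[OF m that] pD(2) by simp
    have p0: "0 \<le> p k" for k using monoD[OF m, of 0 k] pD(1) by simp
    have pL: "p k \<le> int L" if "k \<le> h" for k using monoD[OF m that] pD(3) by simp
    have gal': "p k \<le> int n \<longleftrightarrow> int k \<le> f n" if k: "1 \<le> k" "k \<le> h" for n k
    proof -
      let ?S = "{i. i < h \<and> p (Suc i) \<le> int n}"
      \<comment> \<open>The positions are reindexed from 0, since \<open>down\<close> needs a set
        closed downwards in the naturals.\<close>
      have "{k. 1 \<le> k \<and> k \<le> h \<and> p k \<le> int n} = Suc ` ?S"
        by (auto simp: image_iff) (metis Suc_le_lessD Suc_pred')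
      then have S: "f n = int (card ?S)" by (simp add: f_def \<Psi>_def card_image)
      have "k - 1 \<in> ?S \<longleftrightarrow> k - 1 < card ?S"
        by (rule down) (auto intro: order_trans[OF monoD[OF m]])
      then show ?thesis using k S by auto
    qed
    have fnn: "0 \<le> f n" for n by (simp add: f_def \<Psi>_def)
    have fh: "f n \<le> int h" for n
    proof -
      have "card {k. 1 \<le> k \<and> k \<le> h \<and> p k \<le> int n} \<le> card {1..h}" by (rule card_mono) auto
      then show ?thesis by (simp add: f_def \<Psi>_def)
    qed
    \<comment> \<open>Extension to the artificial end points \<open>0\<close> and
      \<open>h + 1\<close>; for the latter \<open>n \<le> L\<close> is essential.\<close>
    have gal: "p k \<le> int n \<longleftrightarrow> int k \<le> f n" if kn: "k \<le> h + 1" "n \<le> L" for n k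
    proof -
      consider "k = 0" | "1 \<le> k" "k \<le> h" | "k = h + 1" using kn by linarith
      then show ?thesis
        by cases (use gal' pD(1) fnn[of n] fh[of n] pD(4)[of "h + 1"] kn(2) in auto)
    qed
    have f0: "f 0 = 0"
      using gal'[of 1 0] pD(2) h fnn[of 0] by simp
    have fL: "f n = int h" if "n \<ge> L" for n
      using gal'[of h n] pD(3) that h fh[of n] by simp
    have bal: "f (a + l) - f a \<le> f (b + l) - f b + 1" if ab: "a + l \<le> L" "b + l \<le> L" for a b l
    proof (rule ccontr)
      assume c: "\<not> ?thesis"
      \<comment> \<open>The window at \<open>b\<close> lies strictly between the positions
        \<open>j\<close> and \<open>j + m\<close>, whose distance is thus at least
        \<open>l + 1\<close>. The window at \<open>a\<close> contains the positions \<open>i\<close>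
        to \<open>i + m\<close>, whose distance is thus at most \<open>l - 1\<close>.\<close>
      define j where "j = nat (f b)"
      define i where "i = nat (f a) + 1"
      have fm: "f b \<le> f (b + l)"
        unfolding f_def \<Psi>_def by (auto intro!: card_mono)
      define m where "m = nat (f (b + l) - f b) + 1"
      have j: "int j = f b" "int i = f a + 1" "int m = f (b + l) - f b + 1"
        using fnn fm by (simp_all add: j_def i_def m_def)
      have jm: "j + m \<le> h + 1" using j fh[of "b + l"] by linarith
      have im: "i + m \<le> h" using j c fh[of "a + l"] by linarith
      have "p j \<le> int b" using gal[of j b] j jm ab by simp
      moreover have "p (j + m) > int (b + l)" using gal[of "j + m" "b + l"] j jm ab by simp
      moreover have "p i > int a" using gal[of i a] j im ab by simp
      moreover have "p (i + m) \<le> int (a + l)" using gal[of "i + m" "a + l"] j im ab c by simp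
      moreover have "p (j + m) - p j \<le> p (i + m) - p i + 1"
        using pD(5)[of i m j] im jm by (simp add: i_def)
      ultimately show False by simp
    qed
    have "\<Phi> f = p"
    proof
      fix k
      show "\<Phi> f k = p k"
      proof (cases "k \<le> h + 1")
        case True
        have "p k \<le> int L + 1" using monoD[OF m True] pD(4)[of "h + 1"] by simp
        then have "n \<le> L \<and> f n < int k \<longleftrightarrow> n < nat (p k)" for n
          using gal[OF True, of n] by (cases "n \<le> L") auto
        then have "{n. n \<le> L \<and> f n < int k} = {..<nat (p k)}" by blast
        then show ?thesis using p0 by (simp add: \<Phi>_def)
      next
        case False
        have "{n. n \<le> L \<and> f n < int k} = {..L}" using False by (auto intro: le_less_trans[OF fh])
        then show ?thesis using pD(4)[of k] False by (simp add: \<Phi>_def)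
      qed
    qed
    moreover have "f \<in> bal_paths L (int h)"
      unfolding bal_paths_def using f0 fL bal by blast
    ultimately show ?thesis by (simp add: f_def)
  qed
  have "bij_betw \<Phi> (bal_paths L (int h)) (dual_paths h (int L))"
    by (rule bij_betw_byWitness[where f' = \<Psi>]) (use bw pd in auto)
  then show ?thesis by (simp add: \<Phi>_def)
qed

text \<open>For \<open>L \<le> 0\<close> both sides vanish, since
  \<open>1 \<le> p 1 \<le> p h \<le> L\<close> is impossible. Admitting all integers spares the
  recurrence a case distinction for negative lengths.\<close>

lemma s_eq_card_dual_paths:
  fixes h :: nat and L :: int
  assumes h: "h \<ge> 2"
  shows "s L (int h) = card (dual_paths h L)" "finite (dual_paths h L)"
proof -
  have "s L (int h) = card (dual_paths h L) \<and> finite (dual_paths h L)"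
  proof (cases "L > 0")
    case True
    define n where "n = nat L"
    have n: "L = int n" "n > 0" using True by (simp_all add: n_def)
    note b = bij_bal_paths_dual_paths[OF h n(2)]
    show ?thesis
      using bij_betw_same_card[OF b] bij_betw_finite[OF b] s_eq_card_bal_paths[OF n(2), of "int h"]
      by (simp add: n(1))
  next
    case False
    have "dual_paths h L = {}"
    proof (rule ccontr)
      assume "dual_paths h L \<noteq> {}"
      then obtain p where p: "p \<in> dual_paths h L" by blast
      have "p 1 \<le> p h" using monoD[OF dual_paths_mono[OF p h]] h by simp
      then show False using dual_pathsD(2,3)[OF p] False by simp
    qed
    then show ?thesis using False h by (simp add: s_def)
  qed
  then show "s L (int h) = card (dual_paths h L)" "finite (dual_paths h L)" by auto
qed

section \<open>Dual paths classified by their outer gaps\<close>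

text \<open>Both outer gaps are at least 2, so one can be taken from each of the
  \<open>h + 1\<close> gaps. Any two windows of \<open>m\<close> gaps both lose \<open>m\<close>, so
  their comparison is unaffected.\<close>

lemma card_dual_paths_00:
  "card {p \<in> dual_paths h L. p 1 \<noteq> 1 \<and> p h \<noteq> L} = card (dual_paths h (L - int h - 1))"
proof (rule bij_betw_same_card)
  let ?A = "{p \<in> dual_paths h L. p 1 \<noteq> 1 \<and> p h \<noteq> L}"
  let ?B = "dual_paths h (L - int h - 1)"
  let ?c = "\<lambda>k. int (min k (h + 1))"
  have c: "?c (i + m) - ?c i = int m" if "i + m \<le> h + 1" for i m
    using that by auto
  have "(\<lambda>k. p k - ?c k) \<in> ?B" if "p \<in> ?A" for p
  proof -
    have p: "p \<in> dual_paths h L" "p 1 \<noteq> 1" "p h \<noteq> L" using that by auto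
    have "p (j + m) - ?c (j + m) - (p j - ?c j) \<le> p (i + m) - ?c (i + m) - (p i - ?c i) + 1"
      if "1 \<le> i" "i + m \<le> h" "j + m \<le> h + 1" for i j m
      using dual_pathsD(5)[OF p(1) that] c[of i m] c[of j m] that by linarith
    then show ?thesis using dual_pathsD(1-4)[OF p(1)] p(2,3) by (auto simp: dual_paths_def)
  qed
  moreover have "(\<lambda>k. p k + ?c k) \<in> ?A" if "p \<in> ?B" for p
  proof -
    have "p (j + m) + ?c (j + m) - (p j + ?c j) \<le> p (i + m) + ?c (i + m) - (p i + ?c i) + 1"
      if ijm: "1 \<le> i" "i + m \<le> h" "j + m \<le> h + 1" for i j m
      using dual_pathsD(5)[OF \<open>p \<in> ?B\<close> ijm] c[of i m] c[of j m] ijm by linarith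
    then show ?thesis using dual_pathsD(1-4)[OF that] by (auto simp: dual_paths_def)
  qed
  ultimately show "bij_betw (\<lambda>p k. p k - ?c k) ?A ?B"
    by (intro bij_betw_byWitness[where f' = "\<lambda>p k. p k + ?c k"] image_subsetI) simp_all
qed

text \<open>Reversing the sequence of gaps exchanges the two ends. For \<open>k > h + 1\<close> the
  truncated difference \<open>h + 1 - k\<close> is 0, which gives the required constant tail
  \<open>L + 1\<close>.\<close>

lemma card_dual_paths_rev:
  "card {p \<in> dual_paths h L. p 1 \<noteq> 1 \<and> p h = L} = card {p \<in> dual_paths h L. p 1 = 1 \<and> p h \<noteq> L}"
proof (rule bij_betw_same_card)
  let ?r = "\<lambda>p k. L + 1 - p (h + 1 - k) :: int"
  have inv: "?r (?r p) = p" if "p \<in> dual_paths h L" for p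
  proof
    fix k show "?r (?r p) k = p k"
      using dual_pathsD(4)[OF that, of k] dual_pathsD(4)[OF that, of "h + 1"]
      by (cases "k \<le> h + 1") auto
  qed
  have C: "?r p (j + m) - ?r p j \<le> ?r p (i + m) - ?r p i + 1"
    if p: "p \<in> dual_paths h L" and "1 \<le> i" "i + m \<le> h" "j + m \<le> h + 1" for p i j m
  proof -
    have "p (h + 1 - (j + m) + m) - p (h + 1 - (j + m)) \<le>
        p (h + 1 - (i + m) + m) - p (h + 1 - (i + m)) + 1"
      using that by (intro dual_pathsD(5)[OF p]) auto
    moreover have "h + 1 - (j + m) + m = h + 1 - j" "h + 1 - (i + m) + m = h + 1 - i"
      using that by auto
    ultimately show ?thesis by simp
  qed
  have r: "?r p \<in> dual_paths h L" if p: "p \<in> dual_paths h L" for p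
    using C[OF p] dual_pathsD(1-4)[OF p] by (auto simp: dual_paths_def)
  show "bij_betw ?r {p \<in> dual_paths h L. p 1 \<noteq> 1 \<and> p h = L} {p \<in> dual_paths h L. p 1 = 1 \<and> p h \<noteq> L}"
    by (rule bij_betw_byWitness[where f' = ?r]) (use inv r in auto)
qed

text \<open>If an inner gap were at most 1, all gaps would be at most 2. Together with the first gap
  1, the \<open>h + 1\<close> gaps would then add up to at most \<open>2 * h\<close>, but their sum
  is \<open>L + 1\<close>.\<close>

lemma dual_paths_gap_ge_2:
  assumes p: "p \<in> dual_paths h L" and p1: "p 1 = 1" and L: "L \<ge> 2 * int h"
    and i: "1 \<le> i" "i < h"
  shows "2 \<le> p (Suc i) - p i"
proof (rule ccontr)
  assume c: "\<not> ?thesis"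
  have step: "p (Suc k) - p k \<le> 2" if "k \<le> h" for k
    using dual_pathsD(5)[OF p, of i 1 k] that i c by simp
  have lin: "p (a + n) - p a \<le> 2 * int n" if "a + n \<le> h + 1" for a n
    using that
  proof (induction n)
    case (Suc n) then show ?case using step[of "a + n"] by simp
  qed simp
  have "p i \<le> 1 + 2 * (int i - 1)" using lin[of 1 "i - 1"] i p1 by (simp add: of_nat_diff)
  moreover have "p (h + 1) - p (Suc i) \<le> 2 * (int h - int i)"
    using lin[of "Suc i" "h - i"] i by (simp add: of_nat_diff)
  ultimately show False using dual_pathsD(4)[OF p, of "h + 1"] c L by simp
qed

text \<open>The first gap stays 1 and the other \<open>h\<close> gaps lose one each; the last one
  may become 1, so the right end is unrestricted in the target. Only windows starting at
  \<open>0\<close> are delicate, as they lose just \<open>m - 1\<close>.\<close>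

lemma card_dual_paths_10:
  assumes h: "h \<ge> 2" and L: "L \<ge> 2 * int h"
  shows "card {p \<in> dual_paths h L. p 1 = 1 \<and> p h \<noteq> L} = card {p \<in> dual_paths h (L - int h). p 1 = 1}"
proof (rule bij_betw_same_card)
  let ?A = "{p \<in> dual_paths h L. p 1 = 1 \<and> p h \<noteq> L}"
  let ?B = "{p \<in> dual_paths h (L - int h). p 1 = 1}"
  let ?c = "\<lambda>k. int (min k (h + 1) - 1)"
  have "(\<lambda>k. p k - ?c k) \<in> ?B" if "p \<in> ?A" for p
  proof -
    have p: "p \<in> dual_paths h L" and p1: "p 1 = 1" and ph: "p h \<noteq> L" using that by auto
    note pD = dual_pathsD[OF p]
    have "p (j + m) - ?c (j + m) - (p j - ?c j) \<le> p (i + m) - ?c (i + m) - (p i - ?c i) + 1"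
      if ijm: "1 \<le> i" "i + m \<le> h" "j + m \<le> h + 1" for i j m
    proof -
      have ci: "?c (i + m) - ?c i = int m" using ijm by auto
      consider "m = 0" | "j \<ge> 1" | "j = 0" "m > 0" by linarith
      then show ?thesis
      proof cases
        case 2
        then have "?c (j + m) - ?c j = int m" using ijm by auto
        then show ?thesis using ci pD(5)[OF ijm] by linarith
      next
        case 3
        \<comment> \<open>The first gap of each window is split off and the remaining
          \<open>m - 1\<close> gaps are compared. The gap split off from the inner window is at
          least 2 against 1, which makes up for the unequal loss.\<close>
        have "p (1 + (m - 1)) - p 1 \<le> p (i + 1 + (m - 1)) - p (i + 1) + 1"
          by (rule pD(5)) (use ijm 3 in auto)
        then have "p m \<le> p (i + m) - p (Suc i) + 2" using 3 p1 by simp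
        moreover have "2 \<le> p (Suc i) - p i"
          by (rule dual_paths_gap_ge_2[OF p p1 L]) (use ijm 3 in auto)
        moreover have "?c (j + m) - ?c j = int m - 1" using ijm 3 by auto
        ultimately show ?thesis using ci 3 pD(1) by simp
      qed simp
    qed
    then show ?thesis using pD(1-4) p1 ph h by (auto simp: dual_paths_def)
  qed
  moreover have "(\<lambda>k. p k + ?c k) \<in> ?A" if "p \<in> ?B" for p
  proof -
    have p: "p \<in> dual_paths h (L - int h)" and p1: "p 1 = 1" using that by auto
    note pD = dual_pathsD[OF p]
    have "p (j + m) + ?c (j + m) - (p j + ?c j) \<le> p (i + m) + ?c (i + m) - (p i + ?c i) + 1"
      if ijm: "1 \<le> i" "i + m \<le> h" "j + m \<le> h + 1" for i j m
    proof -
      have "?c (i + m) - ?c i = int m" "?c (j + m) - ?c j \<le> int m" using ijm by auto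
      then show ?thesis using pD(5)[OF ijm] by linarith
    qed
    then show ?thesis using pD(1-4) p1 h by (auto simp: dual_paths_def)
  qed
  ultimately show "bij_betw (\<lambda>p k. p k - ?c k) ?A ?B"
    by (intro bij_betw_byWitness[where f' = "\<lambda>p k. p k + ?c k"] image_subsetI) simp_all
qed

text \<open>The inner gaps form a path of length \<open>h - 1\<close> and height
  \<open>L - 1\<close>, and their mutual constraints are its balance condition. Its mean step is at
  least 1, hence so is every step, and this makes the constraints involving an outer gap 1
  automatic.\<close>

lemma card_dual_paths_11:
  assumes h: "h \<ge> 2" and L: "L \<ge> int h"
  shows "card {p \<in> dual_paths h L. p 1 = 1 \<and> p h = L} = card (bal_paths (h - 1) (L - 1))"
proof (rule bij_betw_same_card)
  let ?A = "{p \<in> dual_paths h L. p 1 = 1 \<and> p h = L}"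
  let ?B = "bal_paths (h - 1) (L - 1)"
  let ?f = "\<lambda>p n. p (min n (h - 1) + 1) - 1 :: int"
  let ?g = "\<lambda>f k. if k = 0 then 0 else if k \<le> h then 1 + f (k - 1) else L + 1 :: int"
  have "?f p \<in> ?B \<and> ?g (?f p) = p" if "p \<in> ?A" for p
  proof
    have p: "p \<in> dual_paths h L" and p1: "p 1 = 1" and ph: "p h = L" using that by auto
    note pD = dual_pathsD[OF p]
    have "?f p (a + l) - ?f p a \<le> ?f p (b + l) - ?f p b + 1"
      if "a + l \<le> h - 1" "b + l \<le> h - 1" for a b l
      using pD(5)[of "b + 1" l "a + 1"] that h by (simp add: min_def)
    then show "?f p \<in> ?B" using p1 ph h by (auto simp: bal_paths_def)
    show "?g (?f p) = p"
    proof
      fix k show "?g (?f p) k = p k" using pD(1) pD(4)[of k] h by auto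
    qed
  qed
  moreover have "?g f \<in> ?A \<and> ?f (?g f) = f" if f: "f \<in> ?B" for f
  proof
    note fD = bal_pathsD[OF f]
    have "1 \<le> (L - 1) div int (h - 1)"
      using zdiv_mono1[of "int (h - 1)" "L - 1" "int (h - 1)"] h L by (simp add: of_nat_diff)
    then have step: "f (Suc n) - f n \<ge> 1" if "n < h - 1" for n
      using bal_paths_step(1)[OF f that] by linarith
    have C: "?g f (j + m) - ?g f j \<le> ?g f (i + m) - ?g f i + 1"
      if ijm: "1 \<le> i" "i + m \<le> h" "j + m \<le> h + 1" for i j m
    proof -
      have gi: "?g f (i + m) - ?g f i = f (i - 1 + m) - f (i - 1)" using ijm by auto
      have fw: "f (a + m) - f a \<le> ?g f (i + m) - ?g f i + 1" if "a + m \<le> h - 1" for a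
        unfolding gi by (rule fD(3)) (use that ijm in auto)
      \<comment> \<open>For a window with one outer gap, its \<open>m - 1\<close> inner gaps are
        compared with the first \<open>m - 1\<close> gaps of the window at \<open>i\<close>; the
        last gap there, at least 1, pays for the outer gap.\<close>
      have fw': "f (a + (m - 1)) - f a + 1 \<le> ?g f (i + m) - ?g f i + 1"
        if "a + (m - 1) \<le> h - 1" "m > 0" for a
      proof -
        have "f (a + (m - 1)) - f a \<le> f (i - 1 + (m - 1)) - f (i - 1) + 1"
          by (rule fD(3)) (use that ijm in auto)
        moreover have "f (Suc (i - 1 + (m - 1))) - f (i - 1 + (m - 1)) \<ge> 1"
          by (rule step) (use that ijm in auto)
        moreover have "Suc (i - 1 + (m - 1)) = i - 1 + m" using that by simp
        ultimately show ?thesis unfolding gi by simp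
      qed
      consider "m = 0" | "j \<ge> 1" "j + m \<le> h" | "j = 0" "m > 0" | "j \<ge> 1" "j + m = h + 1" "m > 0"
        using ijm by linarith
      then show ?thesis
      proof cases
        case 2
        then have "?g f (j + m) - ?g f j = f (j - 1 + m) - f (j - 1)" by auto
        then show ?thesis using fw[of "j - 1"] 2 by simp
      next
        case 3
        then have "?g f (j + m) - ?g f j = f (0 + (m - 1)) - f 0 + 1" using ijm fD(1) by simp
        then show ?thesis using fw'[of 0] 3 ijm by simp
      next
        case 4
        then have "?g f (j + m) - ?g f j = f (j - 1 + (m - 1)) - f (j - 1) + 1"
          using ijm fD(2)[of "h - 1"] by (simp add: algebra_simps)
        then show ?thesis using fw'[of "j - 1"] 4 ijm by simp
      qed simp
    qed
    show "?g f \<in> ?A"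
      using C fD(1) fD(2)[of "h - 1"] h unfolding dual_paths_def by auto
    show "?f (?g f) = f"
    proof
      fix n show "?f (?g f) n = f n"
        using fD(2)[of n] fD(2)[of "h - 1"] h by (cases "n \<le> h - 1") (auto simp: min_def)
    qed
  qed
  ultimately show "bij_betw ?f ?A ?B"
    by (intro bij_betw_byWitness[where f' = ?g]) auto
qed

section \<open>The recurrence in the length\<close>

text \<open>The classification expresses \<open>s L h\<close> through \<open>card (E10 L)\<close>,
  which is reduced to \<open>card (E10 (L - int h))\<close>. The same expression at
  \<open>L - int h\<close> then eliminates this unknown; both lengths are at least
  \<open>h\<close>.\<close>

lemma s_recurrence:
  fixes h :: nat and L :: int
  assumes h: "h \<ge> 2" and L: "L \<ge> 2 * int h"
  shows "int (s L (int h)) = int (s (L - int h) (int h)) + int (s (L - int h - 1) (int h))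
    - int (s (L - 2 * int h - 1) (int h)) + int (s (int h - 1) (L - 1)) + int (s (int h - 1) (L - 2))"
proof -
  define A where "A = dual_paths h"
  \<comment> \<open>The two digits tell whether the left and the right outer gap equal 1.\<close>
  define E00 where "E00 = (\<lambda>L. {p \<in> A L. p 1 \<noteq> 1 \<and> p h \<noteq> L})"
  define E01 where "E01 = (\<lambda>L. {p \<in> A L. p 1 \<noteq> 1 \<and> p h = L})"
  define E10 where "E10 = (\<lambda>L. {p \<in> A L. p 1 = 1 \<and> p h \<noteq> L})"
  define E11 where "E11 = (\<lambda>L. {p \<in> A L. p 1 = 1 \<and> p h = L})"
  note defs = A_def E00_def E01_def E10_def E11_def
  have fin: "finite (A L)" for L unfolding A_def by (rule s_eq_card_dual_paths(2)[OF h])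
  have finE: "finite (E00 L)" "finite (E01 L)" "finite (E10 L)" "finite (E11 L)" for L
    using fin[of L] by (auto simp: E00_def E01_def E10_def E11_def)
  have cA: "s L (int h) = card (A L)" for L unfolding A_def by (rule s_eq_card_dual_paths(1)[OF h])
  have c00: "card (E00 L) = s (L - int h - 1) (int h)" for L
    unfolding cA using card_dual_paths_00 by (simp add: defs)
  have c01: "card (E01 L) = card (E10 L)" for L
    using card_dual_paths_rev by (simp add: defs)
  have c11: "card (E11 L) = s (int h - 1) (L - 1)" if "L \<ge> int h" for L
    using card_dual_paths_11[OF h that] s_eq_card_bal_paths(1)[of "h - 1" "L - 1"] h
    by (simp add: defs of_nat_diff)
  have split1: "card {p \<in> A L. p 1 = 1} = card (E10 L) + card (E11 L)" for L
  proof -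
    have "{p \<in> A L. p 1 = 1} = E10 L \<union> E11 L" "E10 L \<inter> E11 L = {}"
      by (auto simp: E10_def E11_def)
    then show ?thesis using card_Un_disjoint[OF finE(3) finE(4)] by metis
  qed
  have split2: "card {p \<in> A L. p 1 \<noteq> 1} = card (E00 L) + card (E01 L)" for L
  proof -
    have "{p \<in> A L. p 1 \<noteq> 1} = E00 L \<union> E01 L" "E00 L \<inter> E01 L = {}"
      by (auto simp: E00_def E01_def)
    then show ?thesis using card_Un_disjoint[OF finE(1) finE(2)] by metis
  qed
  have "card (A L) = card {p \<in> A L. p 1 = 1} + card {p \<in> A L. p 1 \<noteq> 1}" for L
    using fin[of L] by (subst card_Un_disjoint[symmetric]) (auto intro!: arg_cong[of _ _ card])
  then have split: "s L (int h) = s (L - int h - 1) (int h) + 2 * card (E10 L) + s (int h - 1) (L - 1)"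
    if "L \<ge> int h" for L
    using split1[of L] split2[of L] cA[of L] c00[of L] c01[of L] c11[OF that] by simp
  have "card (E10 L) = card (E10 (L - int h)) + s (int h - 1) (L - int h - 1)"
    using card_dual_paths_10[OF h L] split1[of "L - int h"] c11[of "L - int h"] L by (simp add: defs)
  \<comment> \<open>The two heights differ by \<open>h - 1\<close>, the length of the words
    counted.\<close>
  moreover have "s (int h - 1) (L - int h - 1) = s (int h - 1) (L - 2)"
  proof -
    have "(L - int h - 1) mod (int h - 1) = (L - int h - 1 + (int h - 1)) mod (int h - 1)"
      by (simp only: mod_add_self2)
    then show ?thesis using h by (simp add: s_def)
  qed
  ultimately show ?thesis
    using split[of L] split[of "L - int h"] L by (simp add: algebra_simps)
qed

section \<open>Heights zero and one\<close>

lemma s_height_0: "s (int L) 0 = 1"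
proof (cases "L = 0")
  case False
  have "bal_paths L 0 = {\<lambda>_. 0}"
  proof (intro equalityI subsetI)
    fix f assume f: "f \<in> bal_paths L 0"
    have "mono f" using bal_paths_mono[OF f] False by simp
    have "f n = 0" for n
      using monoD[OF \<open>mono f\<close>, of 0 n] monoD[OF \<open>mono f\<close>, of n "max n L"] bal_pathsD(1,2)[OF f] by force
    then show "f \<in> {\<lambda>_. 0}" by auto
  qed (auto simp: bal_paths_def)
  then show ?thesis using s_eq_card_bal_paths(1)[of L 0] False by simp
qed (simp add: s_def)

text \<open>A path of height 1 makes a single unit jump, at any of \<open>L\<close> places. Counting
  paths covers \<open>L = 1\<close> too, where the height of the words is reduced to 0.\<close>

lemma s_height_1: "s (int L) 1 = L"
proof (cases "L = 0")
  case False
  let ?e = "\<lambda>k n :: nat. of_bool (k < n) :: int"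
  have "bal_paths L 1 = ?e ` {..<L}"
  proof (intro equalityI subsetI)
    fix f assume f: "f \<in> bal_paths L 1"
    note fD = bal_pathsD[OF f]
    have m: "mono f" using bal_paths_mono[OF f] False by simp
    define k where "k = (LEAST k. f (Suc k) = 1)"
    have ex: "f (Suc (L - 1)) = 1" using fD(2)[of L] False by simp
    have k1: "f (Suc k) = 1" unfolding k_def by (rule LeastI[of "\<lambda>k. f (Suc k) = 1", OF ex])
    have kL: "k < L" using Least_le[of "\<lambda>k. f (Suc k) = 1", OF ex] False by (simp add: k_def)
    have "f n = ?e k n" for n
    proof (cases "k < n")
      case True
      have "1 \<le> f n" using monoD[OF m, of "Suc k" n] True k1 by simp
      moreover have "f n \<le> 1" using monoD[OF m, of n "max n L"] fD(2)[of "max n L"] by simp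
      ultimately show ?thesis using True by simp
    next
      case False
      have "f n \<le> 1" "0 \<le> f n"
        using monoD[OF m, of n "max n L"] fD(2)[of "max n L"] monoD[OF m, of 0 n] fD(1) by simp_all
      moreover have "f n \<noteq> 1"
      proof
        assume "f n = 1"
        then obtain n' where "n = Suc n'" using fD(1) by (cases n) auto
        then show False using not_less_Least[of n' "\<lambda>k. f (Suc k) = 1"] \<open>f n = 1\<close> False
          by (simp add: k_def)
      qed
      ultimately show ?thesis using False by simp
    qed
    then have "f = ?e k" by auto
    then show "f \<in> ?e ` {..<L}" using kL by blast
  qed (auto simp: bal_paths_def)
  moreover have "inj ?e"
  proof (rule injI)
    fix k k' assume "?e k = ?e k'"
    then have "k < n \<longleftrightarrow> k' < n" for n by (metis of_bool_eq_iff)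
    from this[of k] this[of k'] show "k = k'" by auto
  qed
  ultimately have "card (bal_paths L 1) = L" by (simp add: card_image inj_on_subset)
  then show ?thesis using s_eq_card_bal_paths(1)[of L 1] False by simp
qed (simp add: s_def)

section \<open>Generating functions\<close>

lemma s_mod:
  assumes "a mod L = b mod L" "L > 0"
  shows "s L a = s L b"
  using assms by (simp add: s_def)

lemma V_poly_nth: "V_poly n h $ L = (if L < n then of_nat (s (int L) (int h)) else 0)"
  by (simp add: V_poly_def fps_sum_nth fps_X_power_nth if_distrib cong: if_cong)

text \<open>The factors with exponents \<open>h\<close> and \<open>h + 1\<close> produce the left
  side of the recurrence. The inhomogeneous part is periodic with period \<open>h - 1\<close>, so
  the remaining factor cuts it down to a single period, the polynomial
  \<open>B_poly h\<close>.\<close>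

lemma S_series_mult_denominator:
  assumes h: "h \<ge> 2"
  shows "S_series h * ((1 - fps_X ^ (h - 1)) * (1 - fps_X ^ h) * (1 - fps_X ^ (h + 1))) = F_poly h"
proof -
  define c where "c = (\<lambda>L. rat_of_nat (s L (int h)))"
  define e where "e = (\<lambda>L. rat_of_nat (s (int h - 1) L))"
  \<comment> \<open>From degree \<open>2 * h\<close> on, \<open>(1 + fps_X) * T\<close> has the
    coefficients \<open>e (n - 1) + e (n - 2)\<close>. Starting \<open>T\<close> at
    \<open>2 * h - 1\<close> leaves one surplus coefficient \<open>e (2 * h - 2) = 1\<close> there,
    cancelled by the term \<open>- fps_X ^ (2 * h - 1)\<close>.\<close>
  define T where "T = Abs_fps (\<lambda>n. if n \<ge> 2 * h - 1 then e (int n - 1) else 0)"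
  have c_neg: "c L = 0" if "L \<le> 0" for L
    using that h by (simp add: c_def s_def)
  have e_mod: "e a = e b" if "a mod (int h - 1) = b mod (int h - 1)" for a b
    using s_mod[OF that] h by (simp add: e_def)
  have rec: "c L - c (L - int h) - c (L - int (h + 1)) + c (L - int (2 * h + 1)) = e (L - 1) + e (L - 2)"
    if "L \<ge> 2 * int h" for L
  proof -
    have "L - int (h + 1) = L - int h - 1" "L - int (2 * h + 1) = L - 2 * int h - 1" by simp_all
    then show ?thesis
      using arg_cong[OF s_recurrence[OF h that], of rat_of_int] by (simp only: c_def e_def of_int_add of_int_diff of_int_of_nat_eq)
  qed
  have V_nth: "V_poly m h $ n = (if n < m then c (int n) else 0)" for m n
    by (simp add: V_poly_nth c_def)
  have S_nth: "S_series h $ n = c (int n)" for n by (simp add: S_series_def c_def)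
  have eB: "T * (1 - fps_X ^ (h - 1)) = B_poly h"
  proof (rule fps_ext)
    fix n
    have B: "B_poly h $ n = (if 2 * h - 1 \<le> n \<and> n \<le> 3 * h - 3 then e (int n - 2 * int h + 1) else 0)"
    proof -
      have "B_poly h $ n = (\<Sum>r = 0..h - 2. if n = r + 2 * h - 1 then e (int r) else 0)"
        by (simp add: B_poly_def fps_sum_nth fps_X_power_nth e_def if_distrib cong: if_cong)
      also have "\<dots> = (\<Sum>r \<in> {0..h - 2}. if r = n - (2 * h - 1) then (if 2 * h - 1 \<le> n then e (int r) else 0) else 0)"
        by (rule sum.cong) (use h in auto)
      also have "\<dots> = (if 2 * h - 1 \<le> n \<and> n \<le> 3 * h - 3 then e (int n - 2 * int h + 1) else 0)"
        using h by (auto simp: of_nat_diff algebra_simps)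
      finally show ?thesis .
    qed
    have "(T * (1 - fps_X ^ (h - 1))) $ n = T $ n - (if n < h - 1 then 0 else T $ (n - (h - 1)))"
      by (simp add: right_diff_distrib fps_X_power_mult_right_nth)
    also have "\<dots> = B_poly h $ n"
    proof -
      consider "n < 2 * h - 1" | "2 * h - 1 \<le> n" "n \<le> 3 * h - 3" | "n > 3 * h - 3" by linarith
      then show ?thesis
      proof cases
        case 2
        have "int n - 1 = int n - 2 * int h + 1 + 2 * (int h - 1)" by simp
        then have "(int n - 1) mod (int h - 1) = (int n - 2 * int h + 1) mod (int h - 1)"
          by (metis mod_mult_self1)
        from e_mod[OF this] show ?thesis using 2 h by (auto simp: T_def B)
      next
        case 3
        have "int n - 1 = int n - int h + (int h - 1)" by simp
        then have "(int n - 1) mod (int h - 1) = (int n - int h) mod (int h - 1)"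
          by (metis mod_add_self2)
        from e_mod[OF this] show ?thesis using 3 h by (auto simp: T_def B of_nat_diff)
      qed (use h in \<open>auto simp: T_def B\<close>)
    qed
    finally show "(T * (1 - fps_X ^ (h - 1))) $ n = B_poly h $ n" .
  qed
  have main: "S_series h * ((1 - fps_X ^ h) * (1 - fps_X ^ (h + 1))) =
    V_poly (2 * h) h - V_poly h h * fps_X ^ h - V_poly (h - 1) h * fps_X ^ (h + 1)
        - fps_X ^ (2 * h - 1) + (1 + fps_X) * T"
  proof (rule fps_ext)
    fix n
    have shift: "(S_series h * fps_X ^ k) $ n = c (int n - int k)" for k
      by (auto simp: fps_X_power_mult_right_nth S_nth of_nat_diff c_neg)
    have "S_series h * ((1 - fps_X ^ h) * (1 - fps_X ^ (h + 1))) =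
        S_series h - S_series h * fps_X ^ h - S_series h * fps_X ^ (h + 1)
        + S_series h * fps_X ^ (2 * h + 1)"
      by (simp add: algebra_simps power_add mult_2 mult_2_right)
    then have lhs: "(S_series h * ((1 - fps_X ^ h) * (1 - fps_X ^ (h + 1)))) $ n =
        c (int n) - c (int n - int h) - c (int n - int (h + 1)) + c (int n - int (2 * h + 1))"
      by (simp only: fps_sub_nth fps_add_nth shift S_nth)
    have T1: "((1 + fps_X) * T) $ n = T $ n + (if n = 0 then 0 else T $ (n - 1))"
      by (simp add: distrib_right)
    have e0: "e (2 * int h - 2) = 1"
    proof -
      have "(2 * int h - 2) mod (int h - 1) = 0 mod (int h - 1)"
        by (metis dvd_triv_right mod_0 mod_0_imp_dvd dvd_imp_mod_0 mult_2 right_diff_distrib' mult.right_neutral)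
      then have "e (2 * int h - 2) = e 0" by (rule e_mod)
      then show ?thesis using s_height_0[of "h - 1"] h by (simp add: e_def of_nat_diff)
    qed
    have rhs: "(V_poly (2 * h) h - V_poly h h * fps_X ^ h - V_poly (h - 1) h * fps_X ^ (h + 1)
        - fps_X ^ (2 * h - 1) + (1 + fps_X) * T) $ n =
      (if n < 2 * h then c (int n) else 0)
      - (if n < 2 * h then c (int n - int h) else 0)
      - (if n < 2 * h then c (int n - int (h + 1)) else 0)
      - (if n = 2 * h - 1 then 1 else 0) + (T $ n + (if n = 0 then 0 else T $ (n - 1)))"
    proof -
      \<comment> \<open>Each of the three products with a \<open>V_poly\<close> is a shifted copy of
        the series, cut off at the same degree \<open>2 * h\<close>. Below it the left side agrees,
        as its shift by \<open>2 * h + 1\<close> contributes nothing yet.\<close>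
      have V: "(V_poly m h * fps_X ^ k) $ n = (if n < 2 * h then c (int n - int k) else 0)"
        if "m + k = 2 * h" for m k
      proof (cases "n < k")
        case True
        then show ?thesis using that by (simp add: fps_X_power_mult_right_nth c_neg)
      next
        case False
        then have "n - k < m \<longleftrightarrow> n < 2 * h" using that by linarith
        then show ?thesis using False by (simp add: fps_X_power_mult_right_nth V_nth of_nat_diff)
      qed
      have "h + h = 2 * h" "(h - 1) + (h + 1) = 2 * h" using h by simp_all
      from this[THEN V] show ?thesis
        by (simp only: fps_add_nth fps_sub_nth T1 V_nth fps_X_power_nth)
    qed
    consider "n < 2 * h - 1" | "n = 2 * h - 1" | "n \<ge> 2 * h" by linarith
    then show "(S_series h * ((1 - fps_X ^ h) * (1 - fps_X ^ (h + 1)))) $ n =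
      (V_poly (2 * h) h - V_poly h h * fps_X ^ h - V_poly (h - 1) h * fps_X ^ (h + 1)
        - fps_X ^ (2 * h - 1) + (1 + fps_X) * T) $ n"
      unfolding lhs rhs
    proof cases
      case 3
      then show "c (int n) - c (int n - int h) - c (int n - int (h + 1)) + c (int n - int (2 * h + 1)) =
        (if n < 2 * h then c (int n) else 0)
      - (if n < 2 * h then c (int n - int h) else 0)
      - (if n < 2 * h then c (int n - int (h + 1)) else 0)
      - (if n = 2 * h - 1 then 1 else 0) + (T $ n + (if n = 0 then 0 else T $ (n - 1)))"
        using rec[of "int n"] h by (auto simp: T_def of_nat_diff)
    qed (use h e0 in \<open>auto simp: T_def c_neg of_nat_diff\<close>)
  qed
  have "S_series h * ((1 - fps_X ^ (h - 1)) * (1 - fps_X ^ h) * (1 - fps_X ^ (h + 1))) =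
    (1 - fps_X ^ (h - 1)) * (S_series h * ((1 - fps_X ^ h) * (1 - fps_X ^ (h + 1))))"
    by (simp only: ac_simps)
  also have "\<dots> = F_poly h"
    unfolding main F_poly_def eB[symmetric] by (simp only: distrib_left distrib_right mult_1_left ac_simps)
  finally show ?thesis .
qed

lemma fps_eq_divideI:
  fixes a b c :: "'a::field fps"
  assumes "a * b = c" "b $ 0 \<noteq> 0"
  shows "a = c / b"
proof -
  have "b \<noteq> 0" using assms(2) by auto
  then show ?thesis using nonzero_mult_div_cancel_right[of b a] assms(1) by simp
qed

theorem theorem10:
  shows "S_series 0 = 1 / (1 - fps_X) \<and>
    S_series 1 = fps_X / (1 - fps_X)\<^sup>2 \<and>
    (\<forall>h::nat. h \<ge> 2 \<longrightarrow>
      S_series h =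
        F_poly h / ((1 - fps_X ^ (h - 1)) * (1 - fps_X ^ h) * (1 - fps_X ^ (h + 1))))"
proof (intro conjI allI impI)
  show "S_series 0 = 1 / (1 - fps_X)"
  proof (rule fps_eq_divideI)
    show "S_series 0 * (1 - fps_X) = 1"
      by (rule fps_ext) (auto simp: S_series_def s_height_0 algebra_simps)
  qed simp
  show "S_series 1 = fps_X / (1 - fps_X)\<^sup>2"
  proof (rule fps_eq_divideI)
    have "S_series 1 * (1 - fps_X) = fps_X * Abs_fps (\<lambda>_. 1)"
      by (rule fps_ext) (auto simp: S_series_def s_height_1 algebra_simps of_nat_diff)
    moreover have "Abs_fps (\<lambda>_. 1) * (1 - fps_X) = (1 :: rat fps)"
      by (rule fps_ext) (auto simp: algebra_simps)
    ultimately show "S_series 1 * (1 - fps_X)\<^sup>2 = fps_X"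
      by (simp only: power2_eq_square mult.assoc[symmetric]) (simp only: mult.assoc mult_1_right)
  qed (simp add: power2_eq_square)
  fix h :: nat assume h: "h \<ge> 2"
  show "S_series h = F_poly h / ((1 - fps_X ^ (h - 1)) * (1 - fps_X ^ h) * (1 - fps_X ^ (h + 1)))"
    by (rule fps_eq_divideI[OF S_series_mult_denominator[OF h]]) (use h in simp)
qed

end
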